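(* Let $\eta>0$ and let $f$ be any probability mass function on the non-negative integers, with $f(k)>0$ for all $k\ge 0$, with mean $\mu$ and $\sum_{k=0}^\infty k^{1+\eta}f(k)<\infty$; let $F$ be its cumulative distribution function. Then for any $-1<\rho<0$ there exists a probability mass function $f_\rho$ on the non-negative integers, with mean $\mu_\rho$ and cumulative distribution function $F_\rho$, which satisfies \[ \lim_{k\to\infty}\frac{1-F_\rho(k)}{1-F(k)}=\frac{\mu_\rho}{\mu}. \] Moreover, setting $f_\rho^\ast(k)=k f_\rho(k)/\mu_\rho$, for any $\varepsilon>0$ and any sequence of graphs $G_n\in\mathcal{G}_{\eta,\varepsilon}(f_\rho,f_\rho^\ast)$, \[ \mathbb{P}\left(\widetilde{\rho}(G_n)>\rho\right)\ \ge\ 1-O\left(n^{-1+\kappa}+n^{-\varepsilon+3\kappa/4}+\mathbb{P}(\Omega_n^c)\right)\qquad(n\to\infty), \] where $\kappa=\min(\varepsilon,1/2)$.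
   Context: Graphs are finite undirected multigraphs (self-loops and multiple edges allowed; a self-loop contributes 2 to the degree) and may be random. A degree sequence of length $n$ is a (possibly random) vector $\mathbf{D}_n=(D_1,\dots,D_n)$ of non-negative integers with even sum $L_n=\sum_{i=1}^n D_i$. Define $f_n(k)=\frac1n\sum_{i=1}^n \mathbf{1}\{D_i=k\}$ and $f_n^\ast(k)=\frac{1}{L_n}\sum_{i=1}^n k\,\mathbf{1}\{D_i=k\}$ (with $f_n^\ast\equiv 0$ if $L_n=0$), with cumulative functions $F_n(k)=\sum_{t\le k}f_n(t)$ and $F_n^\ast(k)=\sum_{t\le k}f_n^\ast(t)$ (vanishing at $-1$). For pmfs $g,g^\ast$ on $\{0,1,2,\dots\}$ with $G(k)=\sum_{t\le k}g(t)$ and $\eta,\varepsilon>0$, write $G_n\in\mathcal{G}_{\eta,\varepsilon}(g,g^\ast)$ if $G_n$ is a graph on $n$ nodes, with degree sequence $\mathbf{D}_n$, such that $\sum_{k\ge0}k^{1+\eta}g(k)<\infty$ and $\mathbb{P}(\Omega_n)\to1$, where \[ \Omega_n=\Big\{\max\Big\{\sum_{k=0}^\infty|F_n(k)-G(k)|,\ \sum_{k=0}^\infty|f_n^\ast(k)-g^\ast(k)|\Big\}\le n^{-\varepsilon}\Big\}. \] In the claim $\Omega_n$ is this event for $(g,g^\ast)=(f_\rho,f_\rho^\ast)$. Each undirected edge $i-j$ is replaced by two directed edges $i\to j$ and $j\to i$ (so there are $L_n$ directed edges); $\sum_{i\to j\in G_n}$ is the sum over these. Put $\mathcal{F}_n^\ast(k)=F_n^\ast(k)+F_n^\ast(k-1)$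 and \[ \widetilde{\rho}(G_n)=\frac{3}{L_n}\sum_{i\to j\in G_n}\mathcal{F}_n^\ast(D_i)\mathcal{F}_n^\ast(D_j)-3 . \] Constants in $O(\cdot)$ do not depend on $n$. *)

theory Defs
  imports
    "HOL-Probability.Probability"
    "HOL-Library.Uprod"
    "HOL-Library.Landau_Symbols"
begin

text \<open>
  A multigraph on the node set \<open>{1..n}\<close> is its finite multiset of undirected edges; the loop at
  \<open>i\<close> is the unordered pair \<open>Upair i i\<close>.
\<close>

type_synonym multigraph = "nat uprod multiset"

definition is_multigraph :: "nat \<Rightarrow> multigraph \<Rightarrow> bool" where
  "is_multigraph n E \<longleftrightarrow> (\<forall>e\<in>#E. set_uprod e \<subseteq> {1..n})"

lift_definition endpoints :: "'a uprod \<Rightarrow> 'a multiset" is "\<lambda>(i, j). {#i, j#}"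
  by auto

lemma endpoints_Upair [simp]: "endpoints (Upair i j) = {#i, j#}"
  by transfer simp

text \<open>A loop has its node twice among its endpoints, so it contributes 2 to the degree.\<close>

definition node_degree :: "multigraph \<Rightarrow> nat \<Rightarrow> nat" where
  "node_degree E i = (\<Sum>e\<in>#E. count (endpoints e) i)"

text \<open>The two orientations of an edge; a loop at \<open>i\<close> yields two copies of \<open>(i, i)\<close>.\<close>

lift_definition orientations :: "'a uprod \<Rightarrow> ('a \<times> 'a) multiset" is
  "\<lambda>(i, j). {#(i, j), (j, i)#}"
  by auto

lemma orientations_Upair [simp]: "orientations (Upair i j) = {#(i, j), (j, i)#}"
  by transfer simp

definition directed_edges :: "multigraph \<Rightarrow> (nat \<times> nat) multiset" where
  "directed_edges E = (\<Sum>e\<in>#E. orientations e)"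


definition cumul :: "(nat \<Rightarrow> real) \<Rightarrow> nat \<Rightarrow> real" where
  "cumul h k = (\<Sum>t\<le>k. h t)"

text \<open>In the following, \<open>D 1, \<dots>, D n\<close> is a degree sequence of length \<open>n\<close>.\<close>

definition degree_total :: "nat \<Rightarrow> (nat \<Rightarrow> nat) \<Rightarrow> nat" where
  "degree_total n D = (\<Sum>i=1..n. D i)"

definition emp_pmf :: "nat \<Rightarrow> (nat \<Rightarrow> nat) \<Rightarrow> nat \<Rightarrow> real" where
  "emp_pmf n D k = (\<Sum>i=1..n. of_bool (D i = k)) / real n"

text \<open>This is identically 0 if the total degree is 0, since \<open>x / 0 = 0\<close>.\<close>

definition emp_pmf_star :: "nat \<Rightarrow> (nat \<Rightarrow> nat) \<Rightarrow> nat \<Rightarrow> real" where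
  "emp_pmf_star n D k = (\<Sum>i=1..n. real k * of_bool (D i = k)) / real (degree_total n D)"

text \<open>The sum of the size-biased empirical distribution function at \<open>k\<close> and at \<open>k - 1\<close>, the latter
  being the empty sum if \<open>k = 0\<close>.\<close>

definition emp_cdf_star2 :: "nat \<Rightarrow> (nat \<Rightarrow> nat) \<Rightarrow> nat \<Rightarrow> real" where
  "emp_cdf_star2 n D k = (\<Sum>t\<le>k. emp_pmf_star n D t) + (\<Sum>t<k. emp_pmf_star n D t)"

text \<open>Spearman's rho of the degrees at the two ends of a directed edge. The value \<open>-3\<close> that
  the formula gives to a graph without edges is a junk value.\<close>

definition spearman_rho :: "nat \<Rightarrow> multigraph \<Rightarrow> real" where
  "spearman_rho n E =
     3 / real (degree_total n (node_degree E)) *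
       (\<Sum>(i, j)\<in>#directed_edges E.
          emp_cdf_star2 n (node_degree E) (node_degree E i) * emp_cdf_star2 n (node_degree E) (node_degree E j)) - 3"

text \<open>The first series converges whenever \<open>g\<close> has a finite mean, which the moment condition in
  \<open>graph_class\<close> guarantees; the second one always converges.\<close>

definition Omega :: "real \<Rightarrow> nat pmf \<Rightarrow> nat pmf \<Rightarrow> nat \<Rightarrow> multigraph set" where
  "Omega \<epsilon> g gs n =
     {E. max (\<Sum>k. \<bar>cumul (emp_pmf n (node_degree E)) k - cumul (pmf g) k\<bar>)
             (\<Sum>k. \<bar>emp_pmf_star n (node_degree E) k - pmf gs k\<bar>) \<le> real n powr (- \<epsilon>)}"

text \<open>
  There are only countably many multigraphs on \<open>{1..n}\<close>, so the law of any random multigraph on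
  these nodes is a \<open>pmf\<close>. Everything below depends on this law only, hence a random graph is
  represented by its law and a sequence of random graphs by a sequence of laws.
\<close>

definition graph_class ::
    "real \<Rightarrow> real \<Rightarrow> nat pmf \<Rightarrow> nat pmf \<Rightarrow> (nat \<Rightarrow> multigraph pmf) set" where
  "graph_class \<eta> \<epsilon> g gs =
     {G. (\<forall>n. \<forall>E\<in>set_pmf (G n). is_multigraph n E) \<and>
         summable (\<lambda>k. real k powr (1 + \<eta>) * pmf g k) \<and>
         (\<lambda>n. measure_pmf.prob (G n) (Omega \<epsilon> g gs n)) \<longlonglongrightarrow> 1}"

end

theory Submission
  imports Defs
begin

text \<open>
  Move all the mass that the size-biased law \<open>k f(k) / \<mu>\<close> has below a large threshold \<open>K\<close> to the
  value 1, and let \<open>f\<^sub>\<rho>\<close> be the law with this size-biased version. The tail of \<open>f\<^sub>\<rho>\<close> is proportional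
  to that of \<open>f\<close>, while almost all half-edges of a graph in \<open>\<Omega>\<^sub>n\<close> belong to nodes of degree 1. If this
  fraction is at least \<open>1 - x\<close>, then at least the fraction \<open>1 - 2x\<close> of the directed edges joins two
  such nodes, whose scores are at least \<open>1 - x\<close>; hence Spearman's rho is at least
  \<open>3 (1 - 2x) (1 - x)\<^sup>2 - 3 \<ge> -12x\<close>, whatever the graph. So the event in question contains \<open>\<Omega>\<^sub>n\<close> for
  large \<open>n\<close>, and the error term is just \<open>\<P>(\<Omega>\<^sub>n\<^sup>c)\<close>.
\<close>

section \<open>Directed edges and half-edges: double counting\<close>

lemma fst_directed_edges: "image_mset fst (directed_edges E) = (\<Sum>e\<in>#E. endpoints e)"
proof (induction E)
  case (add e E)
  then show ?case by (cases e) (simp add: directed_edges_def)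
qed (simp add: directed_edges_def)

lemma snd_directed_edges: "image_mset snd (directed_edges E) = (\<Sum>e\<in>#E. endpoints e)"
proof (induction E)
  case (add e E)
  then show ?case by (cases e) (simp add: directed_edges_def add_mset_commute)
qed (simp add: directed_edges_def)

lemma count_endpoints: "count (\<Sum>e\<in>#E. endpoints e) i = node_degree E i"
  by (induction E) (simp_all add: node_degree_def)

lemma set_mset_endpoints: "set_mset (endpoints e) = set_uprod e"
  by (cases e) simp

text \<open>Node \<open>i\<close> occurs among the half-edges exactly \<open>node_degree E i\<close>
  times, so grouping them by node gives the weights. That \<open>E\<close> lives on
  \<open>{1..n}\<close> ensures that no half-edge is lost on the right.\<close>

lemma sum_endpoints:
  fixes h :: "nat \<Rightarrow> real"
  assumes "is_multigraph n E"
  shows "(\<Sum>i\<in>#(\<Sum>e\<in>#E. endpoints e). h i) = (\<Sum>i=1..n. real (node_degree E i) * h i)"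
proof -
  let ?M = "\<Sum>e\<in>#E. endpoints e"
  have sub: "set_mset ?M \<subseteq> {1..n}"
    using assms unfolding is_multigraph_def
    by (induction E) (auto simp: set_mset_endpoints)
  have "(\<Sum>i\<in>#M. h i) = (\<Sum>i=1..n. real (count M i) * h i)" if "set_mset M \<subseteq> {1..n}" for M
    using that
  proof (induction M)
    case (add x M)
    have "(\<Sum>i=1..n. real (count (add_mset x M) i) * h i)
        = (\<Sum>i=1..n. (if i = x then h i else 0) + real (count M i) * h i)"
      by (intro sum.cong) (auto simp: algebra_simps)
    with add show ?case by (simp add: sum.distrib sum.delta)
  qed simp
  from this[OF sub] show ?thesis by (simp add: count_endpoints)
qed

lemma sum_directed_edges:
  fixes h :: "nat \<Rightarrow> real"
  assumes "is_multigraph n E"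
  shows "(\<Sum>(i, j)\<in>#directed_edges E. h i) = (\<Sum>i=1..n. real (node_degree E i) * h i)"
    and "(\<Sum>(i, j)\<in>#directed_edges E. h j) = (\<Sum>i=1..n. real (node_degree E i) * h i)"
  using sum_endpoints[OF assms, of h, folded fst_directed_edges]
    sum_endpoints[OF assms, of h, folded snd_directed_edges]
  by (simp_all add: image_mset.compositionality comp_def split_def)

section \<open>Lower bound for Spearman's rho\<close>

lemma emp_pmf_star_nonneg: "emp_pmf_star n D k \<ge> 0"
  by (simp add: emp_pmf_star_def sum_nonneg)

lemma emp_pmf_star_one_le: "emp_pmf_star n D 1 \<le> 1"
proof -
  have "(\<Sum>i=1..n. real 1 * of_bool (D i = 1)) \<le> (\<Sum>i=1..n. real (D i))"
    by (intro sum_mono) auto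
  also have "\<dots> = real (degree_total n D)" by (simp add: degree_total_def)
  finally show ?thesis by (simp only: emp_pmf_star_def divide_le_eq_1) auto
qed

text \<open>Nodes of degree 0 own no half-edges, so only the mass at 1 survives in the two
  sums.\<close>

lemma emp_cdf_star2_one: "emp_cdf_star2 n D 1 = emp_pmf_star n D 1"
proof -
  have "emp_pmf_star n D 0 = 0" by (simp add: emp_pmf_star_def)
  then show ?thesis by (simp add: emp_cdf_star2_def atMost_Suc)
qed

text \<open>A union bound over source and target: at most \<open>2 * (1 - p) * L\<close> of the
  \<open>L\<close> directed edges have an end of degree other than 1. Each remaining one contributes
  \<open>p\<^sup>2\<close>, and no contribution is negative.\<close>

lemma spearman_rho_ge:
  assumes E: "is_multigraph n E" and L: "degree_total n (node_degree E) > 0"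
  defines "p \<equiv> emp_pmf_star n (node_degree E) 1"
  shows "spearman_rho n E \<ge> 3 * p\<^sup>2 * (2 * p - 1) - 3"
proof -
  define D where "D = node_degree E"
  define L where "L = real (degree_total n D)"
  define W where "W = (\<lambda>k. emp_cdf_star2 n D k)"
  \<comment> \<open>\<open>1 - b i - b j\<close> minorises the indicator that both ends have degree
    1. Being linear, its sum splits into sums over sources and over targets, which the degrees alone
    determine.\<close>
  define b :: "nat \<Rightarrow> real" where "b = (\<lambda>i. of_bool (D i \<noteq> 1))"
  have Lpos: "L > 0" using assms by (simp add: L_def D_def)
  have W0: "W k \<ge> 0" for k
    unfolding W_def emp_cdf_star2_def by (intro add_nonneg_nonneg sum_nonneg emp_pmf_star_nonneg)
  have W1: "W 1 = p" by (simp only: W_def emp_cdf_star2_one p_def D_def)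
  have pL: "(\<Sum>i=1..n. of_bool (D i = 1)) = p * L"
    using Lpos by (simp add: p_def emp_pmf_star_def D_def L_def)
  have sumD: "(\<Sum>i=1..n. real (D i) * 1) = L"
    by (simp add: L_def degree_total_def)
  have "(\<Sum>i=1..n. real (D i) * b i) = (\<Sum>i=1..n. real (D i) * 1 - of_bool (D i = 1))"
    by (intro sum.cong) (auto simp: b_def)
  also have "\<dots> = L - p * L" by (simp only: sum_subtractf sumD pL)
  finally have sumb: "(\<Sum>i=1..n. real (D i) * b i) = L - p * L" .
  have lin: "p\<^sup>2 * ((\<Sum>(i, j)\<in>#M. 1) - (\<Sum>(i, j)\<in>#M. b i) - (\<Sum>(i, j)\<in>#M. b j))
      = (\<Sum>(i, j)\<in>#M. p\<^sup>2 * (1 - b i - b j))" for M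
    by (induction M) (auto simp: algebra_simps)
  have "p\<^sup>2 * (L - (L - p * L) - (L - p * L))
      = p\<^sup>2 * ((\<Sum>(i, j)\<in>#directed_edges E. 1) - (\<Sum>(i, j)\<in>#directed_edges E. b i)
                 - (\<Sum>(i, j)\<in>#directed_edges E. b j))"
    using sum_directed_edges(1)[OF E, of "\<lambda>_. 1"] sum_directed_edges[OF E, of b] sumD sumb
    by (simp add: D_def)
  also have "\<dots> = (\<Sum>(i, j)\<in>#directed_edges E. p\<^sup>2 * (1 - b i - b j))"
    by (rule lin)
  also have "\<dots> \<le> (\<Sum>(i, j)\<in>#directed_edges E. W (D i) * W (D j))"
  proof (rule sum_mset_mono, clarify)
    fix i j
    \<comment> \<open>Equality if both ends have degree 1; otherwise the left side is at most
      0.\<close>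
    show "p\<^sup>2 * (1 - b i - b j) \<le> W (D i) * W (D j)"
      using mult_nonneg_nonneg[OF W0 W0, of "D i" "D j"]
      by (auto simp: b_def W1[unfolded One_nat_def] power2_eq_square intro: order_trans[rotated])
  qed
  finally have "3 / L * (p\<^sup>2 * (L - (L - p * L) - (L - p * L)))
      \<le> 3 / L * (\<Sum>(i, j)\<in>#directed_edges E. W (D i) * W (D j))"
    using Lpos by (intro mult_left_mono) auto
  moreover have "3 / L * (p\<^sup>2 * (L - (L - p * L) - (L - p * L))) = 3 * p\<^sup>2 * (2 * p - 1)"
    using Lpos by (simp add: field_simps)
  ultimately show ?thesis
    by (simp add: spearman_rho_def D_def L_def W_def)
qed

lemma spearman_rho_ge_linear:
  assumes E: "is_multigraph n E"
    and p: "emp_pmf_star n (node_degree E) 1 \<ge> 1 - x" and x: "0 \<le> x" "2 * x < 1"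
  shows "spearman_rho n E \<ge> - 12 * x"
proof -
  define p where "p = emp_pmf_star n (node_degree E) 1"
  \<comment> \<open>Without edges the fraction would be \<open>x / 0 = 0\<close>, below
    \<open>1 - x\<close>; this excludes the junk value of \<open>spearman_rho\<close>.\<close>
  have L: "degree_total n (node_degree E) > 0"
    using p x by (cases "degree_total n (node_degree E) = 0") (auto simp: emp_pmf_star_def)
  have px: "p \<ge> 1 - x" "p \<le> 1" using p emp_pmf_star_one_le by (simp_all add: p_def)
  have "1 - 4 * x \<le> (1 - 2 * x) * (1 - 2 * x)" by (simp add: algebra_simps)
  also have "\<dots> \<le> (1 - x)\<^sup>2 * (1 - 2 * x)"
    using x by (intro mult_right_mono) (auto simp: power2_eq_square algebra_simps)
  also have "\<dots> \<le> p\<^sup>2 * (2 * p - 1)"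
    using x px by (intro mult_mono power_mono) auto
  finally show ?thesis using spearman_rho_ge[OF E L] by (simp add: p_def)
qed

section \<open>Degree distributions of graphs in \<Omega>\<close>

lemma emp_pmf_star_summable: "summable (emp_pmf_star n D)"
proof (rule summable_finite)
  show "finite (D ` {1..n})" by simp
  show "emp_pmf_star n D k = 0" if "k \<notin> D ` {1..n}" for k
    using that by (auto simp: emp_pmf_star_def intro!: sum.neutral)
qed

lemma sums_pmf_nat: "pmf (p :: nat pmf) sums 1"
proof -
  have "(\<integral>\<^sup>+ k. ennreal (pmf p k) \<partial>count_space UNIV) = 1"
    by (simp add: nn_integral_pmf)
  then have "(\<lambda>k. ennreal (pmf p k)) sums ennreal 1"
    by (simp add: nn_integral_count_space_nat sums_iff)
  then show ?thesis by (subst (asm) sums_ennreal) auto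
qed

lemma Omega_emp_pmf_star_ge:
  assumes "E \<in> Omega \<epsilon> g gs n"
  shows "emp_pmf_star n (node_degree E) k \<ge> pmf gs k - real n powr (- \<epsilon>)"
proof -
  let ?d = "\<lambda>k. \<bar>emp_pmf_star n (node_degree E) k - pmf gs k\<bar>"
  \<comment> \<open>A single term is bounded by \<open>suminf\<close> only once convergence is
    known; the sum of the two mass functions dominates.\<close>
  have "summable (\<lambda>k. emp_pmf_star n (node_degree E) k + pmf gs k)"
    by (intro summable_add emp_pmf_star_summable sums_summable[OF sums_pmf_nat])
  then have "summable ?d"
    by (rule summable_comparison_test')
       (simp add: abs_le_iff emp_pmf_star_nonneg add_increasing add_increasing2)
  then have "sum ?d {k} \<le> suminf ?d" by (intro sum_le_suminf) auto
  also have "\<dots> \<le> real n powr (- \<epsilon>)" using assms by (simp add: Omega_def)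
  finally show ?thesis by simp
qed

section \<open>Construction of the degree law\<close>

lemma ex_pmf_of_sums:
  fixes h :: "nat \<Rightarrow> real"
  assumes h: "\<And>k. h k \<ge> 0" "h sums S" and S: "S > 0"
  shows "\<exists>p. \<forall>k. pmf p k = h k / S"
proof -
  have "(\<lambda>k. h k / S) sums 1" using sums_divide[OF h(2), of S] S by simp
  then have "(\<lambda>k. ennreal (h k / S)) sums ennreal 1"
    using h S by (subst sums_ennreal) auto
  then have "(\<integral>\<^sup>+ k. ennreal (h k / S) \<partial>count_space UNIV) = 1"
    by (simp add: nn_integral_count_space_nat sums_iff)
  then have "pmf (embed_pmf (\<lambda>k. h k / S)) k = h k / S" for k
    using h S by (intro pmf_embed_pmf) auto
  then show ?thesis by blast
qed

lemma one_minus_cumul_pmf: "(\<lambda>t. pmf p (t + Suc k)) sums (1 - cumul (pmf p) k)"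
  using sums_iff_shift'[of "pmf p" "Suc k" 1] sums_pmf_nat[of p]
  by (simp add: cumul_def lessThan_Suc_atMost)

text \<open>From \<open>K\<close> on the tails are proportional, so the ratio is eventually
  constant; positivity of \<open>p\<close> keeps the denominator nonzero.\<close>

lemma tail_ratio_tendsto:
  assumes pos: "\<forall>k. pmf p k > 0" and eq: "\<And>k. k \<ge> K \<Longrightarrow> pmf q k = c * pmf p k"
  shows "(\<lambda>k. (1 - cumul (pmf q) k) / (1 - cumul (pmf p) k)) \<longlonglongrightarrow> c"
proof (rule tendsto_eventually, rule eventually_sequentiallyI)
  fix k assume "K \<le> k"
  then have "(\<lambda>t. c * pmf p (t + Suc k)) sums (1 - cumul (pmf q) k)"
    using one_minus_cumul_pmf[of q k] by (simp add: eq)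
  with sums_mult[OF one_minus_cumul_pmf[of p k], of c]
  have "1 - cumul (pmf q) k = c * (1 - cumul (pmf p) k)" by (metis sums_unique2)
  moreover have "1 - cumul (pmf p) k > 0"
    using suminf_pos[OF sums_summable[OF one_minus_cumul_pmf[of p k]]] pos
      sums_unique[OF one_minus_cumul_pmf[of p k]] by simp
  ultimately show "(1 - cumul (pmf q) k) / (1 - cumul (pmf p) k) = c" by simp
qed

text \<open>Divide \<open>q\<close> by \<open>k\<close> and normalise by the total \<open>Z\<close>;
  the resulting law has mean \<open>1 / Z\<close>. A size-biased law has no mass at 0, hence the
  assumption.\<close>

lemma ex_pmf_size_biased_inverse:
  fixes q :: "nat pmf"
  assumes "pmf q 0 = 0"
  shows "\<exists>(p :: nat pmf) m. m > 0 \<and> (\<lambda>k. real k * pmf p k) sums m \<and>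
    (\<forall>k. pmf q k = real k * pmf p k / m) \<and> (\<forall>k. pmf p k = m * pmf q k / real k)"
proof -
  have summ: "summable (\<lambda>k. pmf q k / real k)"
    by (rule summable_comparison_test'[OF sums_summable[OF sums_pmf_nat[of q]], of 1])
       (auto simp: divide_le_eq mult_le_cancel_left1)
  define Z where "Z = (\<Sum>k. pmf q k / real k)"
  obtain k where k: "pmf q k \<noteq> 0"
    using set_pmf_not_empty[of q] by (auto simp: set_pmf_eq)
  have "k \<noteq> 0" using k assms by metis
  with k have Z: "Z > 0" unfolding Z_def
    by (intro suminf_pos2[OF summ, of k]) (auto simp: pmf_positive_iff set_pmf_iff)
  obtain p where p: "\<And>k. pmf p k = pmf q k / real k / Z"
    using ex_pmf_of_sums[of "\<lambda>k. pmf q k / real k" Z] summ Z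
    by (auto simp: Z_def summable_sums)
  have eq: "real k * pmf p k = pmf q k / Z" for k
    using assms by (cases "k = 0") (auto simp: p)
  have "(\<lambda>k. real k * pmf p k) sums (1 / Z)"
    unfolding eq by (intro sums_divide sums_pmf_nat)
  then show ?thesis
    using Z eq by (intro exI[of _ p] exI[of _ "1 / Z"]) (auto simp: p)
qed

lemma ex_pmf_concentrated_at_one:
  fixes f :: "nat pmf"
  assumes pos: "\<forall>k. pmf f k > 0" and mean: "(\<lambda>k. real k * pmf f k) sums \<mu>" and \<delta>: "\<delta> > 0"
  shows "\<exists>(q :: nat pmf) K. pmf q 0 = 0 \<and> pmf q 1 \<ge> 1 - \<delta> \<and>
    (\<forall>k\<ge>K. pmf q k = real k * pmf f k / \<mu>)"
proof -
  let ?g = "\<lambda>k. real k * pmf f k"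
  have \<mu>: "\<mu> > 0"
    using suminf_pos2[OF sums_summable[OF mean], of 1] pos sums_unique[OF mean] by simp
  have "(\<lambda>n. \<Sum>k<n. ?g k) \<longlonglongrightarrow> \<mu>" using mean by (simp add: sums_def)
  moreover have "\<mu> - \<delta> * \<mu> < \<mu>" using \<delta> \<mu> by simp
  \<comment> \<open>The bound 2 puts the value 1 below the threshold \<open>K\<close>, so the atom
    created there does not disturb the tail.\<close>
  ultimately have "\<forall>\<^sub>F n in sequentially. (\<Sum>k<n. ?g k) > \<mu> - \<delta> * \<mu> \<and> n \<ge> 2"
    by (intro eventually_conj order_tendstoD(1) eventually_ge_at_top) auto
  then obtain K where K: "(\<Sum>k<K. ?g k) > \<mu> - \<delta> * \<mu>" "K \<ge> 2"
    by (auto simp: eventually_sequentially)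
  define s where "s = (\<Sum>k<K. ?g k)"
  \<comment> \<open>The first \<open>K\<close> size-biased weights are collapsed onto 1, which
    preserves the total \<mu>.\<close>
  define h where "h = (\<lambda>k::nat. if k = 1 then s else if k < K then 0 else ?g k)"
  have "(\<lambda>k. ?g (k + K)) sums (\<mu> - s)"
    using mean unfolding s_def by (subst sums_iff_shift) auto
  moreover have "h (k + K) = ?g (k + K)" for k using K by (simp add: h_def)
  moreover have "(\<Sum>k<K. h k) = (\<Sum>k<K. if k = 1 then s else 0)"
    by (intro sum.cong) (auto simp: h_def)
  then have "(\<Sum>k<K. h k) = s" using K by (simp add: sum.delta)
  ultimately have sums: "h sums \<mu>" using sums_iff_shift[of h K "\<mu> - s"] by simp
  have "s \<ge> 0" by (simp add: s_def sum_nonneg)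
  then have "h k \<ge> 0" for k by (simp add: h_def)
  from ex_pmf_of_sums[OF this sums \<mu>] obtain q where q: "\<And>k. pmf q k = h k / \<mu>" by blast
  have "pmf q 0 = 0" using K by (simp add: q h_def)
  moreover have "pmf q 1 \<ge> 1 - \<delta>"
  proof -
    have "(1 - \<delta>) * \<mu> \<le> s" using K by (simp add: s_def algebra_simps)
    then show ?thesis using \<mu> by (simp add: q h_def pos_le_divide_eq)
  qed
  moreover have "pmf q k = ?g k / \<mu>" if "k \<ge> K" for k using that K by (simp add: q h_def)
  ultimately show ?thesis by blast
qed

theorem theorem2p2:
  fixes \<eta> \<mu> \<rho> :: real and f :: "nat pmf"
  assumes "\<eta> > 0"
    and "\<forall>k. pmf f k > 0"
    and "(\<lambda>k. real k * pmf f k) sums \<mu>"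
    and "summable (\<lambda>k. real k powr (1 + \<eta>) * pmf f k)"
    and "- 1 < \<rho>" and "\<rho> < 0"
  shows "\<exists>(f\<^sub>\<rho> :: nat pmf) (\<mu>\<^sub>\<rho> :: real) (fs\<^sub>\<rho> :: nat pmf).
    (\<lambda>k. real k * pmf f\<^sub>\<rho> k) sums \<mu>\<^sub>\<rho> \<and>
    (\<forall>k. pmf fs\<^sub>\<rho> k = real k * pmf f\<^sub>\<rho> k / \<mu>\<^sub>\<rho>) \<and>
    (\<lambda>k. (1 - cumul (pmf f\<^sub>\<rho>) k) / (1 - cumul (pmf f) k)) \<longlonglongrightarrow> \<mu>\<^sub>\<rho> / \<mu> \<and>
    (\<forall>\<epsilon>>0. \<forall>G\<in>graph_class \<eta> \<epsilon> f\<^sub>\<rho> fs\<^sub>\<rho>.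
      let \<kappa> = min \<epsilon> (1 / 2) in
      \<exists>r\<in>O(\<lambda>n. real n powr (- 1 + \<kappa>) + real n powr (- \<epsilon> + 3 * \<kappa> / 4)
                + measure_pmf.prob (G n) (- Omega \<epsilon> f\<^sub>\<rho> fs\<^sub>\<rho> n)).
        \<forall>\<^sub>F n in sequentially.
          measure_pmf.prob (G n) {E. spearman_rho n E > \<rho>} \<ge> 1 - r n)"
proof -
  \<comment> \<open>One \<delta> is for the mass of \<open>fs\<close> outside 1, another for the
    deviation allowed by \<Omega>. With \<open>x = 2 * \<delta>\<close> the bound
    \<open>- 12 * x\<close> equals \<open>\<rho> / 2\<close>, which exceeds \<rho>.\<close>
  define \<delta> where "\<delta> = - \<rho> / 48"
  have \<delta>: "\<delta> > 0" "2 * (2 * \<delta>) < 1" "- 12 * (2 * \<delta>) > \<rho>" using assms by (auto simp: \<delta>_def)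
  obtain fs :: "nat pmf" and K where fs: "pmf fs 0 = 0" "pmf fs 1 \<ge> 1 - \<delta>"
    "\<And>k. k \<ge> K \<Longrightarrow> pmf fs k = real k * pmf f k / \<mu>"
    using ex_pmf_concentrated_at_one[OF assms(2,3) \<delta>(1)] by blast
  obtain q :: "nat pmf" and m where q: "m > 0" "(\<lambda>k. real k * pmf q k) sums m"
    "\<forall>k. pmf fs k = real k * pmf q k / m" "\<And>k. pmf q k = m * pmf fs k / real k"
    using ex_pmf_size_biased_inverse[OF fs(1)] by blast
  \<comment> \<open>The factor \<open>k\<close> of the size-biasing cancels, which requires
    \<open>k\<close> to be at least 1.\<close>
  have "pmf q k = m / \<mu> * pmf f k" if "k \<ge> max 1 K" for k
    using that by (simp add: q(4) fs(3))
  from tail_ratio_tendsto[OF assms(2) this]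
  have lim: "(\<lambda>k. (1 - cumul (pmf q) k) / (1 - cumul (pmf f) k)) \<longlonglongrightarrow> m / \<mu>" .
  have bound: "\<forall>\<^sub>F n in sequentially. measure_pmf.prob (G n) {E. spearman_rho n E > \<rho>}
      \<ge> 1 - measure_pmf.prob (G n) (- Omega \<epsilon> q fs n)"
    if \<epsilon>: "\<epsilon> > 0" and G: "G \<in> graph_class \<eta> \<epsilon> q fs" for \<epsilon> G
  proof -
    have "(\<lambda>n. real n powr (- \<epsilon>)) \<longlonglongrightarrow> 0"
      by (rule tendsto_neg_powr) (use \<epsilon> filterlim_real_sequentially in auto)
    then have "\<forall>\<^sub>F n in sequentially. real n powr (- \<epsilon>) < \<delta>"
      using \<delta>(1) by (rule order_tendstoD)
    then show ?thesis
    proof eventually_elim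
      case (elim n)
      have "spearman_rho n E > \<rho>" if "E \<in> set_pmf (G n)" "E \<in> Omega \<epsilon> q fs n" for E
      proof -
        have "is_multigraph n E" using G that by (auto simp: graph_class_def)
        moreover have "emp_pmf_star n (node_degree E) 1 \<ge> 1 - 2 * \<delta>"
          using Omega_emp_pmf_star_ge[OF that(2), of 1] fs(2) elim by simp
        ultimately have "spearman_rho n E \<ge> - 12 * (2 * \<delta>)"
          by (rule spearman_rho_ge_linear) (use \<delta> in auto)
        with \<delta>(3) show ?thesis by linarith
      qed
      \<comment> \<open>The inclusion of events holds on the support of \<open>G n\<close>, where
        \<open>E\<close> is a multigraph on \<open>{1..n}\<close>; hence monotonicity almost
        everywhere.\<close>
      then have "measure_pmf.prob (G n) (Omega \<epsilon> q fs n)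
          \<le> measure_pmf.prob (G n) {E. spearman_rho n E > \<rho>}"
        by (intro measure_pmf.finite_measure_mono_AE) (auto simp: AE_measure_pmf_iff)
      then show ?case
        using measure_pmf.prob_compl[of "Omega \<epsilon> q fs n" "G n"] by (simp add: Compl_eq_Diff_UNIV)
    qed
  qed
  show ?thesis
  proof (intro exI conjI allI impI ballI)
    fix \<epsilon> :: real and G assume "\<epsilon> > 0" "G \<in> graph_class \<eta> \<epsilon> q fs"
    then show "let \<kappa> = min \<epsilon> (1 / 2) in
      \<exists>r\<in>O(\<lambda>n. real n powr (- 1 + \<kappa>) + real n powr (- \<epsilon> + 3 * \<kappa> / 4)
                + measure_pmf.prob (G n) (- Omega \<epsilon> q fs n)).
        \<forall>\<^sub>F n in sequentially.
          measure_pmf.prob (G n) {E. spearman_rho n E > \<rho>} \<ge> 1 - r n"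
      unfolding Let_def
      \<comment> \<open>The two powers of \<open>n\<close> are nonnegative, so the error is
        dominated with constant 1.\<close>
      by (intro bexI[of _ "\<lambda>n. measure_pmf.prob (G n) (- Omega \<epsilon> q fs n)"] bound bigoI[of _ 1])
         auto
  qed (use q(2,3) lim in blast)+
qed

end
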